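(* For all integers $m,n\ge 1$, \[R(\mathbf{V}_{m,m},\mathbf{V}_{n,n})=m+n+1.\]
   Context: The Boolean lattice $\mathbf{B}_N$ is the poset $(2^{[N]},\subseteq)$ of all subsets of $[N]=\{1,\dots,N\}$ ordered by inclusion. A poset $\mathbf{Q}$ contains a poset $\mathbf{P}$ as a subposet if there is an injection $\phi$ from the elements of $\mathbf{P}$ to those of $\mathbf{Q}$ with $x\le_{\mathbf{P}} y$ if and only if $\phi(x)\le_{\mathbf{Q}}\phi(y)$. For integers $n\ge m\ge 1$, $\mathbf{V}_{m,n}$ is the poset on $m+n+1$ elements $x,y_1,\dots,y_m,z_1,\dots,z_n$ whose order relations are generated by $x<y_1<\cdots<y_m$ and $x<z_1<\cdots<z_n$. For posets $\mathbf{P}_1,\mathbf{P}_2$, $R(\mathbf{P}_1,\mathbf{P}_2)$ is the minimum $N$ such that for every coloring $c:2^{[N]}\to\{1,2\}$, $\mathbf{B}_N$ contains a subposet isomorphic to $\mathbf{P}_1$ all of whose elements have color $1$ or a subposet isomorphic to $\mathbf{P}_2$ all of whose elements have color $2$. *)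

theory Defs
  imports "HOL-Library.Extended_Nat"
begin

text \<open>
  A poset is given by its reflexive order relation \<open>P\<close>; its set of elements is \<open>Field P\<close>.
\<close>

definition poset_embedding :: "'a rel \<Rightarrow> 'b rel \<Rightarrow> ('a \<Rightarrow> 'b) \<Rightarrow> bool" where
  "poset_embedding P Q \<phi> \<longleftrightarrow>
     inj_on \<phi> (Field P) \<and> \<phi> ` Field P \<subseteq> Field Q \<and>
     (\<forall>x\<in>Field P. \<forall>y\<in>Field P. (x, y) \<in> P \<longleftrightarrow> (\<phi> x, \<phi> y) \<in> Q)"

definition boolean_lattice :: "nat \<Rightarrow> nat set rel" where
  "boolean_lattice N = {(A, B). A \<in> Pow {1..N} \<and> B \<in> Pow {1..N} \<and> A \<subseteq> B}"

datatype V_elem = X | Y nat | Z nat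

definition V_carrier :: "nat \<Rightarrow> nat \<Rightarrow> V_elem set" where
  "V_carrier m n = {X} \<union> Y ` {1..m} \<union> Z ` {1..n}"

definition V_generators :: "nat \<Rightarrow> nat \<Rightarrow> V_elem rel" where
  "V_generators m n =
     ({(X, Y 1), (X, Z 1)} \<union> {(Y i, Y (Suc i)) | i. True} \<union> {(Z j, Z (Suc j)) | j. True})
       \<inter> (V_carrier m n \<times> V_carrier m n)"

definition V_poset :: "nat \<Rightarrow> nat \<Rightarrow> V_elem rel" where
  "V_poset m n = Id_on (V_carrier m n) \<union> (V_generators m n)\<^sup>+"

definition has_mono_copy :: "nat \<Rightarrow> (nat set \<Rightarrow> nat) \<Rightarrow> 'a rel \<Rightarrow> nat \<Rightarrow> bool" where
  "has_mono_copy N c P k \<longleftrightarrow>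
     (\<exists>\<phi>. poset_embedding P (boolean_lattice N) \<phi> \<and> (\<forall>x\<in>Field P. c (\<phi> x) = k))"

definition ramsey_property :: "'a rel \<Rightarrow> 'b rel \<Rightarrow> nat \<Rightarrow> bool" where
  "ramsey_property P1 P2 N \<longleftrightarrow>
     (\<forall>c. c ` Pow {1..N} \<subseteq> {1, 2} \<longrightarrow> has_mono_copy N c P1 1 \<or> has_mono_copy N c P2 2)"

text \<open>
  The minimum is taken in \<^typ>\<open>enat\<close>, so that the value is \<open>\<infinity>\<close> if no \<open>N\<close> has the property;
  an equation with a finite value thus includes the existence of the minimum.
\<close>

definition poset_ramsey :: "'a rel \<Rightarrow> 'b rel \<Rightarrow> enat" where
  "poset_ramsey P1 P2 = Inf {enat N | N. ramsey_property P1 P2 N}"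

lemma Field_boolean_lattice: "Field (boolean_lattice N) = Pow {1..N}"
  by (auto simp: boolean_lattice_def Field_def)

lemma Partial_order_boolean_lattice: "Partial_order (boolean_lattice N)"
  unfolding partial_order_on_def preorder_on_def Field_boolean_lattice
  by (auto simp: boolean_lattice_def refl_on_def trans_def antisym_def Field_def)

lemma V_generators_subset: "V_generators m n \<subseteq> V_carrier m n \<times> V_carrier m n"
  by (auto simp: V_generators_def V_carrier_def)

lemma Field_V_poset: "Field (V_poset m n) = V_carrier m n"
proof -
  have "(V_generators m n)\<^sup>+ \<subseteq> V_carrier m n \<times> V_carrier m n"
    using V_generators_subset by (rule trancl_subset_Sigma)
  then show ?thesis
    by (auto simp: V_poset_def Field_def)
qed

lemma V_poset_iff:
  "(u, v) \<in> V_poset m n \<longleftrightarrow> u \<in> V_carrier m n \<and> v \<in> V_carrier m n \<and>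
     (u = X \<or> (\<exists>i j. u = Y i \<and> v = Y j \<and> i \<le> j) \<or> (\<exists>i j. u = Z i \<and> v = Z j \<and> i \<le> j))"
  (is "?L \<longleftrightarrow> ?R")
proof
  assume ?L
  moreover have ?R if "(u, v) \<in> (V_generators m n)\<^sup>+"
    using that
  proof (induction rule: trancl_induct)
    case (base w)
    then show ?case by (auto simp: V_generators_def V_carrier_def)
  next
    case (step v w)
    then show ?case by (auto simp: V_generators_def V_carrier_def)
  qed
  ultimately show ?R
    by (cases u) (auto simp: V_poset_def)
next
  assume R: ?R
  have XY: "(X, Y (Suc i)) \<in> (V_generators m n)\<^sup>+" if "i < m" for i
    using that
  proof (induction i)
    case 0
    then show ?case by (auto simp: V_generators_def V_carrier_def)
  next
    case (Suc i)
    then have "(Y (Suc i), Y (Suc (Suc i))) \<in> V_generators m n" by (auto simp: V_generators_def V_carrier_def)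
    with Suc show ?case by (auto intro: trancl_into_trancl)
  qed
  have XZ: "(X, Z (Suc i)) \<in> (V_generators m n)\<^sup>+" if "i < n" for i
    using that
  proof (induction i)
    case 0
    then show ?case by (auto simp: V_generators_def V_carrier_def)
  next
    case (Suc i)
    then have "(Z (Suc i), Z (Suc (Suc i))) \<in> V_generators m n" by (auto simp: V_generators_def V_carrier_def)
    with Suc show ?case by (auto intro: trancl_into_trancl)
  qed
  have YY: "(Y i, Y j) \<in> (V_generators m n)\<^sup>*" if "i \<le> j" "1 \<le> i" "j \<le> m" for i j
    using that
  proof (induction j rule: dec_induct)
    case base
    then show ?case by simp
  next
    case (step j)
    then have "(Y j, Y (Suc j)) \<in> V_generators m n" by (auto simp: V_generators_def V_carrier_def)
    with step show ?case by (auto intro: rtrancl_into_rtrancl)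
  qed
  have ZZ: "(Z i, Z j) \<in> (V_generators m n)\<^sup>*" if "i \<le> j" "1 \<le> i" "j \<le> n" for i j
    using that
  proof (induction j rule: dec_induct)
    case base
    then show ?case by simp
  next
    case (step j)
    then have "(Z j, Z (Suc j)) \<in> V_generators m n" by (auto simp: V_generators_def V_carrier_def)
    with step show ?case by (auto intro: rtrancl_into_rtrancl)
  qed
  have "(u, v) \<in> (V_generators m n)\<^sup>*"
  proof (cases "u = X")
    case True
    show ?thesis
    proof (cases v)
      case (Y i)
      with R have "i \<ge> 1" "i \<le> m" by (auto simp: V_carrier_def)
      then show ?thesis using XY[of "i - 1"] True Y by (auto intro: trancl_into_rtrancl)
    next
      case (Z i)
      with R have "i \<ge> 1" "i \<le> n" by (auto simp: V_carrier_def)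
      then show ?thesis using XZ[of "i - 1"] True Z by (auto intro: trancl_into_rtrancl)
    qed (simp add: True)
  next
    case False
    with R show ?thesis by (auto simp: V_carrier_def intro: YY ZZ)
  qed
  with R show ?L
    by (auto simp: V_poset_def rtrancl_eq_or_trancl)
qed

lemma Partial_order_V_poset: "Partial_order (V_poset m n)"
  unfolding partial_order_on_def preorder_on_def Field_V_poset
  by (auto simp: refl_on_def trans_def antisym_def V_poset_iff Field_V_poset V_carrier_def)

end

theory Submission
  imports Defs
begin

text \<open>
  Lower bound: colour the sets with fewer than \<open>m\<close> elements with \<open>1\<close> and all others with \<open>2\<close>.
  On \<open>[m + n]\<close> a chain of \<open>n + 1\<close> sets of colour \<open>2\<close> must end in the top element, but the two
  branches of \<open>V\<^sub>n\<^sub>,\<^sub>n\<close> have different ends.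

  Upper bound, with \<open>N = m + n + 1\<close>: by symmetry \<open>{}\<close> may be assumed to have colour \<open>1\<close>. If
  for some points \<open>a \<noteq> b\<close> both intervals \<open>[{a}, [N] - {b}]\<close> and \<open>[{b}, [N] - {a}]\<close> contain a
  maximal chain with \<open>m\<close> sets of colour \<open>1\<close>, these chains and \<open>{}\<close> give the copy of
  \<open>V\<^sub>m\<^sub>,\<^sub>m\<close>. Otherwise there is a tournament on \<open>[N]\<close> with an arc from \<open>a\<close> to \<open>b\<close> only if every
  maximal chain of \<open>[{a}, [N] - {b}]\<close> has fewer than \<open>m\<close> sets of colour \<open>1\<close>. If \<open>a\<close> has arcs
  to \<open>b\<close> and \<open>c\<close>, let \<open>x\<close> be minimal among the sets of colour \<open>2\<close> in \<open>[{a}, [N] - {b, c}]\<close>.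
  All sets in \<open>[{a}, x]\<close> other than \<open>x\<close> have colour \<open>1\<close>, hence every maximal chain from
  \<open>x \<union> {c}\<close> to \<open>[N] - {b}\<close>, and from \<open>x \<union> {b}\<close> to \<open>[N] - {c}\<close>, has at least \<open>n\<close> sets of
  colour \<open>2\<close>. The only tournament on at least three points without such \<open>a\<close> is the 3-cycle,
  where \<open>m = n = 1\<close> and all sets with one or two elements have colour \<open>2\<close>.
\<close>

section \<open>Chains of sets and maximal chains of intervals\<close>

lemma finite_chain_enumeration:
  fixes S :: "'a set set"
  assumes "finite S" "chain_subset S" "n \<le> card S"
  shows "\<exists>f. (\<forall>i\<in>{1..n}. f i \<in> S) \<and> (\<forall>i\<in>{1..n}. \<forall>j\<in>{1..n}. f i \<subseteq> f j \<longleftrightarrow> i \<le> j)"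
  using assms
proof (induction n arbitrary: S)
  case 0
  then show ?case by simp
next
  case (Suc n)
  have "S \<noteq> {}" using Suc.prems(3) by auto
  \<comment> \<open>The largest set of the chain becomes the value at \<open>Suc n\<close>;
    induction enumerates the rest.\<close>
  then obtain M where M: "M \<in> S" "\<And>T. T \<in> S \<Longrightarrow> T \<subseteq> M"
    using finite_has_maximal[OF Suc.prems(1)] Suc.prems(2) unfolding chain_subset_def by metis
  have "chain_subset (S - {M})" "n \<le> card (S - {M})"
    using Suc.prems M(1) by (auto simp: chain_subset_def)
  then obtain f where f: "\<forall>i\<in>{1..n}. f i \<in> S - {M}"
      "\<forall>i\<in>{1..n}. \<forall>j\<in>{1..n}. f i \<subseteq> f j \<longleftrightarrow> i \<le> j"
    using Suc.IH[of "S - {M}"] Suc.prems(1) by auto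
  have "\<not> M \<subseteq> f i" if "i \<in> {1..n}" for i
    using f(1) M(2) that by blast
  then have "(\<forall>i\<in>{1..Suc n}. (f(Suc n := M)) i \<in> S) \<and>
      (\<forall>i\<in>{1..Suc n}. \<forall>j\<in>{1..Suc n}. (f(Suc n := M)) i \<subseteq> (f(Suc n := M)) j \<longleftrightarrow> i \<le> j)"
    using f M by (auto simp: atLeastAtMostSuc_conv)
  then show ?case by blast
qed

text \<open>For finite \<open>B\<close>, the cardinality condition says that the chain is maximal in \<open>[A, B]\<close>.\<close>

definition saturated_chain :: "'a set \<Rightarrow> 'a set \<Rightarrow> 'a set set \<Rightarrow> bool" where
  "saturated_chain A B S \<longleftrightarrow> (\<forall>T\<in>S. A \<subseteq> T \<and> T \<subseteq> B) \<and> chain_subset S \<and> card S = Suc (card (B - A))"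

text \<open>Infinite sets have \<open>card\<close> 0, so a positive cardinality forces
  finiteness.\<close>

lemma saturated_chain_finite: "saturated_chain A B S \<Longrightarrow> finite S"
  by (rule card_ge_0_finite) (simp add: saturated_chain_def)

lemma saturated_chain_exists:
  assumes "finite B" "A \<subseteq> B"
  shows "\<exists>S. saturated_chain A B S"
proof -
  \<comment> \<open>Induction on the difference \<open>D = B - A\<close>: each new point puts one
    more set on top of the chain.\<close>
  have *: "\<exists>S. saturated_chain A (A \<union> D) S" if "finite D" "A \<inter> D = {}" for D
    using that
  proof (induction D rule: finite_induct)
    case empty
    have "saturated_chain A (A \<union> {}) {A}" by (simp add: saturated_chain_def chain_subset_def)
    then show ?case by blast
  next
    case (insert b D)
    have b: "b \<notin> A" "b \<notin> D" and disj: "A \<inter> D = {}" using insert.prems insert.hyps by simp_all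
    obtain S where S: "saturated_chain A (A \<union> D) S" using insert.IH[OF disj] by blast
    let ?E = "A \<union> insert b D"
    have sub: "A \<subseteq> T" "T \<subseteq> A \<union> D" if "T \<in> S" for T
      using S that by (simp_all add: saturated_chain_def)
    have notin: "?E \<notin> S" using sub(2)[of ?E] b by blast
    have "A \<union> D - A = D" "?E - A = insert b D" using disj b by blast+
    then have "card (insert ?E S) = Suc (card (?E - A))"
      using S notin saturated_chain_finite[OF S] insert.hyps
      by (simp add: saturated_chain_def del: Un_insert_right)
    moreover have "T \<subseteq> ?E" if "T \<in> S" for T using sub(2)[OF that] by blast
    then have "chain_subset (insert ?E S)"
      using S by (simp add: chain_subset_def saturated_chain_def del: Un_insert_right)
    moreover have "A \<subseteq> T \<and> T \<subseteq> ?E" if "T \<in> insert ?E S" for T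
      using sub[of T] that by blast
    ultimately have "saturated_chain A ?E (insert ?E S)"
      unfolding saturated_chain_def by blast
    then show ?case by blast
  qed
  have "A \<union> (B - A) = B" using assms(2) by blast
  with *[of "B - A"] assms(1) show ?thesis by (metis Diff_disjoint finite_Diff)
qed

text \<open>From \<open>B\<close> to \<open>insert e B\<close> is a single step in the lattice, so
  nothing is skipped and the lengths add up to that of a maximal chain.\<close>

lemma saturated_chain_append:
  assumes "saturated_chain A B S" "saturated_chain (insert e B) D S'" "e \<notin> B" "A \<subseteq> B"
    "insert e B \<subseteq> D" "finite D"
  shows "saturated_chain A D (S \<union> S')" "S \<inter> S' = {}"
proof -
  have sub: "A \<subseteq> T" "T \<subseteq> B" if "T \<in> S" for T
    using assms(1) that by (simp_all add: saturated_chain_def)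
  have sub': "insert e B \<subseteq> T" "T \<subseteq> D" if "T \<in> S'" for T
    using assms(2) that unfolding saturated_chain_def by blast+
  show disj: "S \<inter> S' = {}"
    using sub(2) sub'(1) assms(3) by blast
  have "A \<subseteq> T \<and> T \<subseteq> D" if "T \<in> S \<union> S'" for T
    using that sub[of T] sub'[of T] assms(4,5) by blast
  moreover have "T \<subseteq> T'" if "T \<in> S" "T' \<in> S'" for T T'
    using sub(2)[OF that(1)] sub'(1)[OF that(2)] by blast
  then have "chain_subset (S \<union> S')"
    using assms(1,2) unfolding chain_subset_def saturated_chain_def by (metis UnE)
  moreover have "card (S \<union> S') = Suc (card (D - A))"
  proof -
    have fin: "finite (insert e B)" "finite B" "finite A"
      using finite_subset[OF assms(5,6)] finite_subset[OF assms(4)] by simp_all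
    have "card (S \<union> S') = card S + card S'"
      using disj assms(1,2) by (simp add: card_Un_disjoint saturated_chain_finite)
    also have "\<dots> = Suc (card B - card A) + Suc (card D - Suc (card B))"
      using assms(1,2) fin card_Diff_subset[OF fin(3) assms(4)] card_Diff_subset[OF fin(1) assms(5)]
        assms(3) by (simp add: saturated_chain_def)
    also have "\<dots> = Suc (card D - card A)"
      using card_mono[OF fin(2) assms(4)] card_mono[OF assms(6,5)] fin assms(3) by simp
    also have "\<dots> = Suc (card (D - A))"
      using fin assms(4,5) by (subst card_Diff_subset) auto
    finally show ?thesis .
  qed
  ultimately show "saturated_chain A D (S \<union> S')" unfolding saturated_chain_def by blast
qed

section \<open>Copies of V from a bottom set and two chains\<close>

lemma mem_V_carrier_iff:
  "X \<in> V_carrier m n" "Y i \<in> V_carrier m n \<longleftrightarrow> i \<in> {1..m}" "Z i \<in> V_carrier m n \<longleftrightarrow> i \<in> {1..n}"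
  by (auto simp: V_carrier_def)

text \<open>The points \<open>a\<close> and \<open>b\<close> separate the branches: sets of the
  first contain \<open>a\<close> and omit \<open>b\<close>, sets of the second the reverse. As
  neither point is in \<open>x\<close>, no branch set lies below \<open>x\<close>.\<close>

lemma has_mono_copy_V_posetI:
  assumes x: "x \<subseteq> {1..N}" "c x = k"
    and S: "saturated_chain (insert a x) ({1..N} - {b}) S" "m \<le> card {T \<in> S. c T = k}"
    and S': "saturated_chain (insert b x) ({1..N} - {a}) S'" "n \<le> card {T \<in> S'. c T = k}"
    and ab: "a \<notin> x" "b \<notin> x"
  shows "has_mono_copy N c (V_poset m n) k"
proof -
  have fin: "finite {T \<in> S. c T = k}" "finite {T \<in> S'. c T = k}"
    using S(1)[THEN saturated_chain_finite] S'(1)[THEN saturated_chain_finite] by simp_all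
  have chain: "chain_subset {T \<in> S. c T = k}" "chain_subset {T \<in> S'. c T = k}"
    using S(1) S'(1) unfolding saturated_chain_def chain_subset_def by blast+
  obtain f where f: "\<forall>i\<in>{1..m}. f i \<in> {T \<in> S. c T = k}"
      "\<forall>i\<in>{1..m}. \<forall>j\<in>{1..m}. f i \<subseteq> f j \<longleftrightarrow> i \<le> j"
    using finite_chain_enumeration[OF fin(1) chain(1) S(2)] by blast
  obtain g where g: "\<forall>i\<in>{1..n}. g i \<in> {T \<in> S'. c T = k}"
      "\<forall>i\<in>{1..n}. \<forall>j\<in>{1..n}. g i \<subseteq> g j \<longleftrightarrow> i \<le> j"
    using finite_chain_enumeration[OF fin(2) chain(2) S'(2)] by blast
  define \<phi> where "\<phi> = case_V_elem x f g"
  have fS: "f i \<subseteq> {1..N}" "x \<subseteq> f i" "a \<in> f i" "b \<notin> f i" "c (f i) = k" if "i \<in> {1..m}" for i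
    using that f(1) S(1) unfolding saturated_chain_def by blast+
  have gS: "g i \<subseteq> {1..N}" "x \<subseteq> g i" "b \<in> g i" "a \<notin> g i" "c (g i) = k" if "i \<in> {1..n}" for i
    using that g(1) S'(1) unfolding saturated_chain_def by blast+
  have sub: "\<phi> u \<subseteq> {1..N}" "c (\<phi> u) = k" if "u \<in> V_carrier m n" for u
    using that by (cases u; simp add: mem_V_carrier_iff \<phi>_def fS gS x del: One_nat_def)+
  have neg: "\<not> f i \<subseteq> g j" "\<not> g j \<subseteq> f i"
    if "i \<in> {1..m}" "j \<in> {1..n}" for i j
    using fS[OF that(1)] gS[OF that(2)] ab by blast+
  have neg': "\<not> f i \<subseteq> x" if "i \<in> {1..m}" for i using fS[OF that] ab by blast
  have neg'': "\<not> g i \<subseteq> x" if "i \<in> {1..n}" for i using gS[OF that] ab by blast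
  have iff: "(u, v) \<in> V_poset m n \<longleftrightarrow> \<phi> u \<subseteq> \<phi> v" if "u \<in> V_carrier m n" "v \<in> V_carrier m n" for u v
    using that
    by (cases u; cases v)
      (simp_all add: V_poset_iff mem_V_carrier_iff \<phi>_def f(2) g(2) fS(2) gS(2) neg neg' neg'' del: One_nat_def)
  have "inj_on \<phi> (V_carrier m n)"
  proof (rule inj_onI)
    fix u v assume "u \<in> V_carrier m n" "v \<in> V_carrier m n" "\<phi> u = \<phi> v"
    then have "(u, v) \<in> V_poset m n" "(v, u) \<in> V_poset m n" using iff by auto
    then show "u = v" by (auto simp: V_poset_iff)
  qed
  then have "poset_embedding (V_poset m n) (boolean_lattice N) \<phi>"
    unfolding poset_embedding_def Field_V_poset Field_boolean_lattice
    using sub(1) iff by (auto simp: boolean_lattice_def)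
  then show ?thesis
    using sub(2) unfolding has_mono_copy_def Field_V_poset by blast
qed

section \<open>Upper bound: arcs between points\<close>

text \<open>The arc from \<open>a\<close> to \<open>b\<close>. Arcs in both directions may coexist,
  so no tournament has to be selected.\<close>

definition dominates :: "nat \<Rightarrow> (nat set \<Rightarrow> nat) \<Rightarrow> nat \<Rightarrow> nat \<Rightarrow> nat \<Rightarrow> nat \<Rightarrow> bool" where
  "dominates N c k m a b \<longleftrightarrow>
     (\<forall>S. saturated_chain {a} ({1..N} - {b}) S \<longrightarrow> card {T \<in> S. c T = k} < m)"

lemma dominates_or_copy:
  assumes "c {} = k" "a \<noteq> b" "a \<in> {1..N}" "b \<in> {1..N}"
  shows "dominates N c k m a b \<or> dominates N c k m b a \<or> has_mono_copy N c (V_poset m m) k"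
proof (rule ccontr)
  assume no: "\<not> ?thesis"
  then obtain S where S: "saturated_chain {a} ({1..N} - {b}) S" "m \<le> card {T \<in> S. c T = k}"
    unfolding dominates_def not_less[symmetric] by blast
  from no obtain S' where S': "saturated_chain {b} ({1..N} - {a}) S'" "m \<le> card {T \<in> S'. c T = k}"
    unfolding dominates_def not_less[symmetric] by blast
  have "has_mono_copy N c (V_poset m m) k"
    by (rule has_mono_copy_V_posetI[of "{}" N c k a b S m S']) (use assms S S' in auto)
  with no show False by blast
qed

text \<open>Extend \<open>S\<close> downwards by a maximal chain \<open>S0\<close> from
  \<open>{a}\<close> to \<open>x\<close>. The result has at most \<open>m - 1\<close> sets of colour
  \<open>k\<close>, of which \<open>S0\<close> supplies at least \<open>card x - 1\<close>. So at
  most \<open>m - card x\<close> of the \<open>m + n - card x\<close> sets in \<open>S\<close> have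
  colour \<open>k\<close>.\<close>

lemma dominates_imp_many:
  assumes dom: "dominates N c k m a b" and N: "N = m + n + 1"
    and col: "\<And>T. T \<subseteq> {1..N} \<Longrightarrow> c T = k \<or> c T = k'" and kk: "k \<noteq> k'"
    and x: "{a} \<subseteq> x" "x \<subseteq> {1..N} - {b, e}" and e: "e \<in> {1..N}" "e \<noteq> b" and b: "b \<in> {1..N}"
    and below: "\<And>T. {a} \<subseteq> T \<Longrightarrow> T \<subset> x \<Longrightarrow> c T = k"
    and S: "saturated_chain (insert e x) ({1..N} - {b}) S"
  shows "n \<le> card {T \<in> S. c T = k'}"
proof -
  have finx: "finite x" using x(2) finite_subset by blast
  obtain S0 where S0: "saturated_chain {a} x S0"
    using saturated_chain_exists[OF finx x(1)] by blast
  have sat: "saturated_chain {a} ({1..N} - {b}) (S0 \<union> S)" and disj: "S0 \<inter> S = {}"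
    using saturated_chain_append[OF S0 S] x e by auto
  have lt: "card {T \<in> S0 \<union> S. c T = k} < m" using dom sat unfolding dominates_def by blast
  have card0: "card S0 = Suc (card (x - {a}))" and sub0: "\<forall>T\<in>S0. {a} \<subseteq> T \<and> T \<subseteq> x"
    using S0 by (auto simp: saturated_chain_def)
  have card1: "card S = Suc (card ({1..N} - {b} - insert e x))"
    and sub1: "\<forall>T\<in>S. insert e x \<subseteq> T \<and> T \<subseteq> {1..N} - {b}"
    using S by (auto simp: saturated_chain_def)
  have fin: "finite S0" "finite S" using S0 S saturated_chain_finite by blast+
  have "c T = k" if "T \<in> S0 - {x}" for T
    using sub0 that by (intro below) auto
  then have "S0 - {x} \<subseteq> {T \<in> S0. c T = k}" by blast
  then have "card (S0 - {x}) \<le> card {T \<in> S0. c T = k}" using fin by (intro card_mono) auto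
  moreover have "card S0 - 1 \<le> card (S0 - {x})" using fin by (simp add: card_Diff_singleton_if)
  moreover have "card S0 = card x"
    using card0 x(1) finx by (metis card.remove insert_subset)
  ultimately have red0: "card x - 1 \<le> card {T \<in> S0. c T = k}" by linarith
  have "{T \<in> S0 \<union> S. c T = k} = {T \<in> S0. c T = k} \<union> {T \<in> S. c T = k}" by blast
  then have "card {T \<in> S0 \<union> S. c T = k} = card {T \<in> S0. c T = k} + card {T \<in> S. c T = k}"
    using fin disj by (simp add: card_Un_disjoint disjoint_iff)
  moreover have "card S = card {T \<in> S. c T = k} + card {T \<in> S. c T = k'}"
  proof -
    have "c T = k \<or> c T = k'" if "T \<in> S" for T using sub1 that by (intro col) auto
    then have "S = {T \<in> S. c T = k} \<union> {T \<in> S. c T = k'}" by blast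
    moreover have "{T \<in> S. c T = k} \<inter> {T \<in> S. c T = k'} = {}" using kk by auto
    ultimately show ?thesis using fin by (metis (no_types, lifting) card_Un_disjoint finite_Un)
  qed
  moreover have "card S = m + n - card x"
  proof -
    have "{1..N} = insert b (insert e (x \<union> ({1..N} - {b} - insert e x)))" using x e b by auto
    moreover have "card (insert b (insert e (x \<union> ({1..N} - {b} - insert e x)))) =
        Suc (Suc (card x + card ({1..N} - {b} - insert e x)))"
      using x e b finx
      by (subst card_insert_disjoint; (subst card_insert_disjoint)?; (subst card_Un_disjoint)?; force)
    ultimately have "N = Suc (Suc (card x + card ({1..N} - {b} - insert e x)))"
      by (metis card_atLeastAtMost diff_Suc_1)
    then show ?thesis using card1 N by linarith
  qed
  \<comment> \<open>The bounds on \<open>card x\<close> keep the natural subtractions above from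
    truncating.\<close>
  moreover have "card x \<ge> 1" using x(1) finx by (metis card_0_eq insert_not_empty less_one not_le subset_empty)
  moreover have "card x \<le> m + n"
  proof -
    have "x \<subseteq> {1..N} - {b}" using x by auto
    then have "card x \<le> card ({1..N} - {b})" by (intro card_mono) auto
    then show ?thesis using b N by simp
  qed
  ultimately show ?thesis using red0 lt by linarith
qed

text \<open>Both branches start from the same minimal \<open>x\<close>: one takes up
  \<open>e\<close> and avoids \<open>b\<close>, the other the reverse, and
  \<open>dominates_imp_many\<close> counts each.\<close>

lemma dominates_two_imp_copy:
  assumes dom: "dominates N c k m a b" "dominates N c k m a e" and N: "N = m + n + 1"
    and n: "n \<ge> 1"
    and col: "\<And>T. T \<subseteq> {1..N} \<Longrightarrow> c T = k \<or> c T = k'" and kk: "k \<noteq> k'"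
    and in_N: "{a, b, e} \<subseteq> {1..N}" and ne: "a \<noteq> b" "a \<noteq> e" "b \<noteq> e"
  shows "has_mono_copy N c (V_poset n n) k'"
proof -
  define F where "F = {T. {a} \<subseteq> T \<and> T \<subseteq> {1..N} - {b, e} \<and> c T = k'}"
  have "finite F" by (rule finite_subset[of _ "Pow {1..N}"]) (auto simp: F_def)
  moreover have "F \<noteq> {}"
  proof
    \<comment> \<open>Then a maximal chain from \<open>{a}\<close> to \<open>?x\<close> has only
      colour \<open>k\<close> and at least \<open>m + n - 1 \<ge> m\<close> sets; adding
      \<open>{1..N} - {b}\<close> on top contradicts the arc to \<open>b\<close>.\<close>
    assume "F = {}"
    then have all: "c T = k" if "{a} \<subseteq> T" "T \<subseteq> {1..N} - {b, e}" for T
      using that col[of T] by (auto simp: F_def)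
    let ?x = "{1..N} - {b, e}"
    have ax: "{a} \<subseteq> ?x" using in_N ne by auto
    obtain S0 where S0: "saturated_chain {a} ?x S0"
      using saturated_chain_exists[OF _ ax] by blast
    have eq: "insert e ?x = {1..N} - {b}" using in_N ne by auto
    have "saturated_chain (insert e ?x) ({1..N} - {b}) {{1..N} - {b}}"
      unfolding eq by (auto simp: saturated_chain_def chain_subset_def)
    then have "saturated_chain {a} ({1..N} - {b}) (S0 \<union> {{1..N} - {b}})"
      by (rule saturated_chain_append(1)[OF S0]) (use ax eq in auto)
    then have lt: "card {T \<in> S0 \<union> {{1..N} - {b}}. c T = k} < m"
      using dom(1) unfolding dominates_def by blast
    have "S0 \<subseteq> {T \<in> S0 \<union> {{1..N} - {b}}. c T = k}"
      using all S0 by (auto simp: saturated_chain_def)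
    moreover have card0: "card S0 = Suc (card (?x - {a}))" using S0 by (simp add: saturated_chain_def)
    moreover have "finite S0" using S0 by (rule saturated_chain_finite)
    ultimately have "card S0 \<le> card {T \<in> S0 \<union> {{1..N} - {b}}. c T = k}"
      by (intro card_mono) simp_all
    with lt have "card S0 < m" by linarith
    moreover have "card ?x = N - 2" using in_N ne by (subst card_Diff_subset) auto
    then have "card (?x - {a}) = N - 3" using ax by (simp add: card_Diff_singleton_if)
    ultimately show False
      using card0 N n by linarith
  qed
  ultimately obtain x where x: "x \<in> F" and min: "\<And>T. T \<in> F \<Longrightarrow> T \<subseteq> x \<Longrightarrow> T = x"
    using finite_has_minimal[of F] by metis
  \<comment> \<open>Both orders of \<open>b\<close> and \<open>e\<close> are recorded because
    \<open>dominates_imp_many\<close> is used with their roles exchanged.\<close>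
  have xs: "{a} \<subseteq> x" "x \<subseteq> {1..N} - {b, e}" "x \<subseteq> {1..N} - {e, b}" "c x = k'"
    using x by (auto simp: F_def)
  have below: "c T = k" if "{a} \<subseteq> T" "T \<subset> x" for T
    using that min[of T] col[of T] xs by (auto simp: F_def)
  obtain S where S: "saturated_chain (insert e x) ({1..N} - {b}) S"
    using saturated_chain_exists[of "{1..N} - {b}" "insert e x"] xs in_N ne by auto
  obtain S' where S': "saturated_chain (insert b x) ({1..N} - {e}) S'"
    using saturated_chain_exists[of "{1..N} - {e}" "insert b x"] xs in_N ne by auto
  have "n \<le> card {T \<in> S. c T = k'}"
    by (rule dominates_imp_many[OF dom(1) N col kk xs(1,2) _ _ _ below S]) (use in_N ne in auto)
  moreover have "n \<le> card {T \<in> S'. c T = k'}"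
    by (rule dominates_imp_many[OF dom(2) N col kk xs(1,3) _ _ _ below S']) (use in_N ne in auto)
  ultimately show ?thesis
    by (intro has_mono_copy_V_posetI[of x N c k' e b S n S', OF _ _ S _ S']) (use xs in auto)
qed

text \<open>Having fewer than one set of colour \<open>k\<close> means having none, and the interval
  of an arc is a two-element chain. The arc from \<open>a\<close> to \<open>b\<close> thus colours
  \<open>{a}\<close> and \<open>{a, e}\<close>, the arc from \<open>b\<close> to \<open>e\<close>
  colours \<open>{a, b}\<close>.\<close>

lemma dominates_cycle_imp_copy:
  assumes dom: "dominates N c k 1 a b" "dominates N c k 1 b e"
    and N: "{1..N} = {a, b, e}" and ne: "a \<noteq> b" "a \<noteq> e" "b \<noteq> e"
    and col: "\<And>T. T \<subseteq> {1..N} \<Longrightarrow> c T = k \<or> c T = k'"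
  shows "has_mono_copy N c (V_poset 1 1) k'"
proof -
  have *: "c {p} = k'" "c {p, r} = k'"
    if "dominates N c k 1 p q" "{1..N} = {p, q, r}" "p \<noteq> q" "p \<noteq> r" "q \<noteq> r" for p q r
  proof -
    have "{p, q, r} - {q} - {p} = {r}" "{p} \<noteq> {p, r}" using that by auto
    then have "saturated_chain {p} ({1..N} - {q}) {{p}, {p, r}}"
      unfolding that(2) saturated_chain_def chain_subset_def using that(3-) by auto
    then have "card {T \<in> {{p}, {p, r}}. c T = k} = 0"
      using that(1) unfolding dominates_def by blast
    then have "{T \<in> {{p}, {p, r}}. c T = k} = {}" by (subst (asm) card_0_eq) auto
    then have "c {p} \<noteq> k" "c {p, r} \<noteq> k" by blast+
    then show "c {p} = k'" "c {p, r} = k'"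
      using col[of "{p}"] col[of "{p, r}"] unfolding that(2) by blast+
  qed
  have "c {a} = k'" "c {a, e} = k'" using *[OF dom(1) N] ne by auto
  moreover have "c {a, b} = k'" using *(2)[OF dom(2), of a] N ne by (auto simp: insert_commute)
  \<comment> \<open>The bottom is \<open>{a}\<close>; above it each branch interval is a single
    set.\<close>
  ultimately show ?thesis
    by (intro has_mono_copy_V_posetI[of "{a}" N c k' e b "{{a, e}}" 1 "{{a, b}}"])
      (use N ne in \<open>auto simp: saturated_chain_def chain_subset_def card_gt_0_iff Suc_le_eq\<close>)
qed

text \<open>Without a copy, any two points are joined by an arc (\<open>tot\<close>) and each point
  has at most one outgoing arc (\<open>out\<close>).\<close>

lemma has_mono_copy_if_empty_coloured:
  assumes mn: "m \<ge> 1" "n \<ge> 1" and N: "N = m + n + 1" and emp: "c {} = k" and kk: "k \<noteq> k'"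
    and col: "\<And>T. T \<subseteq> {1..N} \<Longrightarrow> c T = k \<or> c T = k'"
  shows "has_mono_copy N c (V_poset m m) k \<or> has_mono_copy N c (V_poset n n) k'"
proof (rule ccontr)
  assume no: "\<not> ?thesis"
  let ?d = "dominates N c k m"
  have tot: "?d a b \<or> ?d b a" if "a \<noteq> b" "a \<in> {1..N}" "b \<in> {1..N}" for a b
    using dominates_or_copy[of c k, OF emp that] no by blast
  have out: "\<not> (?d a b \<and> ?d a e)" if "{a, b, e} \<subseteq> {1..N}" "a \<noteq> b" "a \<noteq> e" "b \<noteq> e" for a b e
    using dominates_two_imp_copy[of N c k m, OF _ _ N mn(2) col kk that] no by blast
  show False
  proof (cases "N = 3")
    case True
    then have m1: "m = 1" "n = 1" using mn N by auto
    have cyc: "\<not> (?d a b \<and> ?d b e)" if "{1..N} = {a, b, e}" "a \<noteq> b" "a \<noteq> e" "b \<noteq> e" for a b e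
      using dominates_cycle_imp_copy[of N c k, OF _ _ that col] no m1 by blast
    \<comment> \<open>The two listings stand for the two cyclic orientations of three
      points.\<close>
    have N3: "{1..N} = {1, 2, 3}" "{1..N} = {1, 3, 2}" using True by auto
    have "?d 1 2 \<or> ?d 2 1" "?d 1 3 \<or> ?d 3 1" "?d 2 3 \<or> ?d 3 2"
      by (rule tot; simp add: True)+
    moreover have "\<not> (?d 1 2 \<and> ?d 1 3)" "\<not> (?d 2 1 \<and> ?d 2 3)" "\<not> (?d 3 1 \<and> ?d 3 2)"
      by (rule out; simp add: True)+
    moreover have "\<not> (?d 1 2 \<and> ?d 2 3)" by (rule cyc[OF N3(1)]) simp_all
    moreover have "\<not> (?d 1 3 \<and> ?d 3 2)" by (rule cyc[OF N3(2)]) simp_all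
    ultimately show False by blast
  next
    case False
    then have "N \<ge> 4" using mn N by auto
    \<comment> \<open>Among four points, six pairs need an arc, but at most four arcs are
      available.\<close>
    then have "{1, 2, 3, 4} \<subseteq> {1..N}" by auto
    then show False
      using tot[of 1 2] tot[of 1 3] tot[of 1 4] tot[of 2 3] tot[of 2 4] tot[of 3 4]
        out[of 1 2 3] out[of 1 2 4] out[of 1 3 4] out[of 2 1 3] out[of 2 1 4] out[of 2 3 4]
        out[of 3 1 2] out[of 3 1 4] out[of 3 2 4] out[of 4 1 2] out[of 4 1 3] out[of 4 2 3]
      by auto
  qed
qed

lemma ramsey_property_V_poset:
  assumes "m \<ge> 1" "n \<ge> 1"
  shows "ramsey_property (V_poset m m) (V_poset n n) (m + n + 1)"
  unfolding ramsey_property_def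
proof (intro allI impI)
  fix c :: "nat set \<Rightarrow> nat"
  assume c: "c ` Pow {1..m + n + 1} \<subseteq> {1, 2}"
  then have col: "c T = 1 \<or> c T = 2" if "T \<subseteq> {1..m + n + 1}" for T using that by auto
  then have col': "c T = 2 \<or> c T = 1" if "T \<subseteq> {1..m + n + 1}" for T using that by blast
  have "c {} = 1 \<or> c {} = 2" using col by blast
  then show "has_mono_copy (m + n + 1) c (V_poset m m) 1 \<or> has_mono_copy (m + n + 1) c (V_poset n n) 2"
  proof
    assume "c {} = 1"
    from has_mono_copy_if_empty_coloured[of m n _ c, OF assms refl this _ col] show ?thesis by auto
  next
    \<comment> \<open>Exchange the colours together with \<open>m\<close> and
      \<open>n\<close>.\<close>
    assume "c {} = 2"
    from has_mono_copy_if_empty_coloured[of n m "m + n + 1" c, OF assms(2,1) _ this _ col'] show ?thesis by auto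
  qed
qed

section \<open>Lower bound\<close>

lemma chain_card_growth:
  fixes f :: "nat \<Rightarrow> 'a set"
  assumes "\<And>i. i < n \<Longrightarrow> f i \<subset> f (Suc i)" "\<And>i. i \<le> n \<Longrightarrow> finite (f i)"
  shows "card (f 0) + n \<le> card (f n)"
  using assms
proof (induction n)
  case (Suc n)
  have "card (f n) < card (f (Suc n))" using Suc.prems by (intro psubset_card_mono) auto
  moreover have "card (f 0) + n \<le> card (f n)" by (rule Suc.IH) (use Suc.prems in auto)
  ultimately show ?case by simp
qed simp

lemma poset_embedding_V_poset_card:
  assumes emb: "poset_embedding (V_poset n n) (boolean_lattice N) \<phi>" and "n \<ge> 1"
  shows "card (\<phi> X) + n \<le> card (\<phi> (Y n))" "card (\<phi> X) + n \<le> card (\<phi> (Z n))"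
proof -
  have sub: "\<phi> u \<subseteq> {1..N}" if "u \<in> V_carrier n n" for u
    using emb that unfolding poset_embedding_def Field_V_poset Field_boolean_lattice by blast
  have less: "\<phi> u \<subset> \<phi> v" if "(u, v) \<in> V_poset n n" "u \<noteq> v" for u v
  proof -
    have uv: "u \<in> V_carrier n n" "v \<in> V_carrier n n" using that by (auto simp: V_poset_iff)
    then have "\<phi> u \<noteq> \<phi> v"
      using emb that(2) unfolding poset_embedding_def Field_V_poset by (meson inj_onD)
    moreover have "\<phi> u \<subseteq> \<phi> v"
      using emb that(1) uv unfolding poset_embedding_def Field_V_poset boolean_lattice_def by blast
    ultimately show ?thesis by blast
  qed
  have fin: "finite (\<phi> u)" if "u \<in> V_carrier n n" for u
    using sub[OF that] finite_subset by blast
  \<comment> \<open>\<open>case_nat X (Y \<circ> Suc)\<close> lists the branch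
    \<open>X, Y 1, Y 2, ...\<close> with \<open>X\<close> at index 0.\<close>
  have "card (\<phi> (case_nat X (Y \<circ> Suc) 0)) + n \<le> card (\<phi> (case_nat X (Y \<circ> Suc) n))"
    by (rule chain_card_growth[of n "\<lambda>i. \<phi> (case_nat X (Y \<circ> Suc) i)"])
      (auto intro!: less fin simp: V_poset_iff V_carrier_def split: nat.split)
  moreover have "card (\<phi> (case_nat X (Z \<circ> Suc) 0)) + n \<le> card (\<phi> (case_nat X (Z \<circ> Suc) n))"
    by (rule chain_card_growth[of n "\<lambda>i. \<phi> (case_nat X (Z \<circ> Suc) i)"])
      (auto intro!: less fin simp: V_poset_iff V_carrier_def split: nat.split)
  ultimately show "card (\<phi> X) + n \<le> card (\<phi> (Y n))" "card (\<phi> X) + n \<le> card (\<phi> (Z n))"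
    using \<open>n \<ge> 1\<close> by (auto split: nat.splits)
qed

text \<open>Every \<open>N \<le> m + n\<close> is excluded directly, as the infimum ranges over all
  \<open>N\<close> with the property.\<close>

lemma not_ramsey_property_V_poset:
  assumes "m \<ge> 1" "n \<ge> 1" "N \<le> m + n"
  shows "\<not> ramsey_property (V_poset m m) (V_poset n n) N"
proof
  assume ramsey: "ramsey_property (V_poset m m) (V_poset n n) N"
  define c :: "nat set \<Rightarrow> nat" where "c = (\<lambda>T. if card T < m then 1 else 2)"
  have "c ` Pow {1..N} \<subseteq> {1, 2}" by (auto simp: c_def)
  then consider "has_mono_copy N c (V_poset m m) 1" | "has_mono_copy N c (V_poset n n) 2"
    using ramsey unfolding ramsey_property_def by blast
  then show False
  proof cases
    case 1
    then obtain \<phi> where \<phi>: "poset_embedding (V_poset m m) (boolean_lattice N) \<phi>"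
        "\<forall>u\<in>V_carrier m m. c (\<phi> u) = 1"
      unfolding has_mono_copy_def Field_V_poset by blast
    then have "c (\<phi> (Y m)) = 1" using assms by (auto simp: V_carrier_def)
    \<comment> \<open>The end of a branch lies \<open>m\<close> strict inclusions above the bottom,
      so it has at least \<open>m\<close> points.\<close>
    then have "card (\<phi> (Y m)) < m" by (auto simp: c_def split: if_splits)
    then show False using poset_embedding_V_poset_card(1)[OF \<phi>(1) assms(1)] by linarith
  next
    case 2
    then obtain \<phi> where \<phi>: "poset_embedding (V_poset n n) (boolean_lattice N) \<phi>"
        "\<forall>u\<in>V_carrier n n. c (\<phi> u) = 2"
      unfolding has_mono_copy_def Field_V_poset by blast
    have carrier: "X \<in> V_carrier n n" "Y n \<in> V_carrier n n" "Z n \<in> V_carrier n n"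
      using assms by (auto simp: V_carrier_def)
    have "c (\<phi> X) = 2" using \<phi>(2) carrier by blast
    then have "card (\<phi> X) \<ge> m" by (auto simp: c_def split: if_splits)
    \<comment> \<open>Both ends have at least \<open>m + n \<ge> N\<close> points and hence equal
      \<open>{1..N}\<close>, against injectivity.\<close>
    then have "card (\<phi> (Y n)) \<ge> N" "card (\<phi> (Z n)) \<ge> N"
      using poset_embedding_V_poset_card[OF \<phi>(1) assms(2)] assms(3) by linarith+
    moreover have "\<phi> (Y n) \<subseteq> {1..N}" "\<phi> (Z n) \<subseteq> {1..N}"
      using \<phi>(1) carrier unfolding poset_embedding_def Field_V_poset Field_boolean_lattice by blast+
    ultimately have "\<phi> (Y n) = \<phi> (Z n)"
      by (metis card_atLeastAtMost card_seteq diff_Suc_1 finite_atLeastAtMost)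
    then show False
      using \<phi>(1) carrier unfolding poset_embedding_def Field_V_poset inj_on_def by blast
  qed
qed

theorem theorem2:
  fixes m n :: nat
  assumes "m \<ge> 1" and "n \<ge> 1"
  shows "poset_ramsey (V_poset m m) (V_poset n n) = enat (m + n + 1)"
  unfolding poset_ramsey_def
proof (rule antisym)
  show "Inf {enat N |N. ramsey_property (V_poset m m) (V_poset n n) N} \<le> enat (m + n + 1)"
    using ramsey_property_V_poset[OF assms] by (intro Inf_lower) blast
  show "enat (m + n + 1) \<le> Inf {enat N |N. ramsey_property (V_poset m m) (V_poset n n) N}"
  proof (rule Inf_greatest)
    fix z assume "z \<in> {enat N |N. ramsey_property (V_poset m m) (V_poset n n) N}"
    then obtain N where N: "z = enat N" "ramsey_property (V_poset m m) (V_poset n n) N" by blast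
    then have "\<not> N \<le> m + n" using not_ramsey_property_V_poset[OF assms] by blast
    then show "enat (m + n + 1) \<le> z" using N(1) by simp
  qed
qed

end
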